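(* Let $G=(V,E)$ be a finite, connected graph with at least two vertices and, for $v\in V$, let $\phi(v)$ be the expected number of steps a random walk started in $v$ needs until hitting $\partial G$. If $f:V \rightarrow \mathbb{R}$ vanishes on $\partial G$, then $$ \sum_{(u,v) \in E} (f(u) - f(v))^2 \geq \sum_{v \in V} \deg(v) \frac{f(v)^2}{\phi(v)},$$ where the terms with $v \in \partial G$ on the right-hand side (of the form $0/0$) are interpreted as $0$.
   Context: Graphs are undirected and simple; $d(\cdot,\cdot)$ is the graph (shortest path) distance and $\deg(v)$ is the number of neighbors of $v$. The sum $\sum_{(u,v)\in E}$ with both endpoints varying runs over all edges, each undirected edge counted once. The random walk moves at each step from the current vertex to a uniformly random neighbor; $\phi(v)=0$ for $v\in\partial G$. The boundary $\partial G \subseteq V$ is defined as follows: $v \in \partial G$ if and only if there exists another vertex $w \in V$ such that $$ \frac{1}{\deg(v)} \sum_{(v,x) \in E} d(x,w) < d(v,w),$$ where this sum runs over all neighbors $x$ of $v$. *)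

theory Defs
  imports "HOL-Probability.Probability" "HOL-Library.Uprod"
    "Graph_Theory.Digraph_Component" "Graph_Theory.Shortest_Path"
begin

text \<open>
  Finite simple undirected graphs are the locale \<^locale>\<open>graph\<close> of \<^theory>\<open>Graph_Theory.Digraph\<close>:
  finite, loopfree, symmetric digraphs without parallel arcs. An undirected edge therefore appears
  there as two opposite arcs; \<open>edges\<close> identifies them, so that it counts every edge once.
\<close>

definition edges :: "('a, 'b) pre_digraph \<Rightarrow> 'a uprod set" where
  "edges G = {Upair u v | u v. u \<rightarrow>\<^bsub>G\<^esub> v}"

lift_definition sq_diff :: "('a \<Rightarrow> real) \<Rightarrow> 'a uprod \<Rightarrow> real" is "\<lambda>f (u, v). (f u - f v)\<^sup>2"
  by (auto simp: power2_commute)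

lemma sq_diff_Upair [simp]: "sq_diff f (Upair u v) = (f u - f v)\<^sup>2"
  by transfer simp

definition neighbours :: "('a, 'b) pre_digraph \<Rightarrow> 'a \<Rightarrow> 'a set" where
  "neighbours G v = {x. v \<rightarrow>\<^bsub>G\<^esub> x}"

definition deg :: "('a, 'b) pre_digraph \<Rightarrow> 'a \<Rightarrow> nat" where
  "deg G v = card (neighbours G v)"

text \<open>Shortest-path distance with unit arc lengths; it is finite on connected graphs.\<close>

definition graph_dist :: "('a, 'b) pre_digraph \<Rightarrow> 'a \<Rightarrow> 'a \<Rightarrow> real" where
  "graph_dist G u v = real_of_ereal (wf_digraph.\<mu> G (\<lambda>_. 1) u v)"

definition boundary :: "('a, 'b) pre_digraph \<Rightarrow> 'a set" where
  "boundary G = {v \<in> verts G. \<exists>w \<in> verts G. w \<noteq> v \<and>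
     (1 / real (deg G v)) * (\<Sum>x\<in>neighbours G v. graph_dist G x w) < graph_dist G v w}"

text \<open>
  \<open>walk_step G v n \<omega>\<close> is the conditional law of the position at time \<open>n\<close>, given the positions
  \<open>\<omega> 0, \<dots>, \<omega> (n - 1)\<close>, of the random walk started in \<open>v\<close>. The law of the whole trajectory is
  obtained from these kernels by the Ionescu-Tulcea theorem.
\<close>

definition walk_step :: "('a, 'b) pre_digraph \<Rightarrow> 'a \<Rightarrow> nat \<Rightarrow> (nat \<Rightarrow> 'a) \<Rightarrow> 'a measure" where
  "walk_step G v n \<omega> =
     measure_pmf (case n of 0 \<Rightarrow> return_pmf v | Suc m \<Rightarrow> pmf_of_set (neighbours G (\<omega> m)))"

lemma Ionescu_Tulcea_walk_step: "Ionescu_Tulcea (walk_step G v) (\<lambda>_. count_space UNIV)"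
proof (rule Ionescu_Tulcea.intro)
  show "walk_step G v n \<in> Pi\<^sub>M {0..<n} (\<lambda>_. count_space UNIV) \<rightarrow>\<^sub>M subprob_algebra (count_space UNIV)"
    for n
  proof (cases n)
    case 0
    then show ?thesis
      by (auto simp: walk_step_def[abs_def] measure_pmf_in_subprob_algebra)
  next
    case (Suc m)
    have "(\<lambda>\<omega>. \<omega> m) \<in> Pi\<^sub>M {0..<n} (\<lambda>_. count_space UNIV) \<rightarrow>\<^sub>M count_space UNIV"
      using Suc by (intro measurable_component_singleton) auto
    then have "(\<lambda>\<omega>. measure_pmf (pmf_of_set (neighbours G (\<omega> m))))
        \<in> Pi\<^sub>M {0..<n} (\<lambda>_. count_space UNIV) \<rightarrow>\<^sub>M subprob_algebra (count_space UNIV)"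
      by (rule measurable_compose)
        (auto simp: measure_pmf_in_subprob_algebra)
    with Suc show ?thesis
      by (simp add: walk_step_def[abs_def])
  qed
qed (simp add: walk_step_def prob_space_measure_pmf)

definition random_walk :: "('a, 'b) pre_digraph \<Rightarrow> 'a \<Rightarrow> (nat \<Rightarrow> 'a) measure" where
  "random_walk G v =
     projective_family.lim UNIV (Ionescu_Tulcea.CI (walk_step G v) (\<lambda>_. count_space UNIV))
       (\<lambda>_. count_space UNIV)"

text \<open>The infimum of the empty set is \<open>\<infinity>\<close>: a trajectory that avoids \<open>B\<close> hits it at time \<open>\<infinity>\<close>.\<close>

definition hitting_time :: "'a set \<Rightarrow> (nat \<Rightarrow> 'a) \<Rightarrow> ennreal" where
  "hitting_time B \<omega> = (INF n\<in>{n. \<omega> n \<in> B}. of_nat n)"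

definition mean_hitting_time :: "('a, 'b) pre_digraph \<Rightarrow> 'a \<Rightarrow> ennreal" where
  "mean_hitting_time G v = (\<integral>\<^sup>+ \<omega>. hitting_time (boundary G) \<omega> \<partial>random_walk G v)"

end

theory Submission
  imports Defs
begin

text \<open>
  Let \<open>B\<close> be the boundary. Off \<open>B\<close>, conditioning on the first step of the walk gives
  \<open>\<phi>(v) = 1 + avg \<phi>\<close>, the average running over the neighbours of \<open>v\<close>. So \<open>\<phi>\<close> is positive there and
  \<open>deg(v) \<phi>(v) - \<Sum> \<phi>(x) = deg(v)\<close>, that is, \<open>\<Delta>\<phi> = deg\<close> off \<open>B\<close> for the graph Laplacian \<open>\<Delta>\<close>.
  A positive function with a known Laplacian bounds the Dirichlet energy from below (Barta's trick,
  or the ground state substitution \<open>f = \<phi> g\<close>): on every edge with \<open>\<phi>(u), \<phi>(v) > 0\<close>,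
  \<open>(f(u) - f(v))\<^sup>2 \<ge> f(u)\<^sup>2/\<phi>(u) (\<phi>(u) - \<phi>(v)) + f(v)\<^sup>2/\<phi>(v) (\<phi>(v) - \<phi>(u))\<close>,
  because the difference of the two sides is the square \<open>\<phi>(u) \<phi>(v) (f(u)/\<phi>(u) - f(v)/\<phi>(v))\<^sup>2\<close>.
  At an endpoint in \<open>B\<close> both \<open>f\<close> and \<open>\<phi>\<close> vanish, its summand counts as \<open>0\<close>, and the inequality
  persists (\<open>square_diff_ge_weighted\<close>). Summed over all edges and regrouped by vertices
  (\<open>sum_arcs_le_sum_edges\<close>), the right-hand side becomes a sum over the vertices off \<open>B\<close>,
  \<open>\<Sum> f(v)\<^sup>2/\<phi>(v) (deg(v) \<phi>(v) - \<Sum> \<phi>(x)) = \<Sum> deg(v) f(v)\<^sup>2/\<phi>(v)\<close>.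

  The first-step equation has to be extracted from a trajectory measure that is built by appending
  one step at a time at the \<^emph>\<open>end\<close>. The hitting time is the number of \<open>n\<close> for which the walk avoids
  \<open>B\<close> up to time \<open>n\<close>, so \<open>\<phi>(v)\<close> is the sum over \<open>n\<close> of the probabilities of these events, which
  depend on finitely many coordinates. Each such probability is an iterate of the transition
  operator killed on \<open>B\<close> (\<open>nn_integral_avoiding\<close>), and powers of a single operator may be peeled off at
  the front just as well as at the end; this replaces a Markov property for the shifted trajectory.
\<close>

section \<open>First-step analysis of the mean hitting time\<close>

definition killed_step :: "('a, 'b) pre_digraph \<Rightarrow> 'a set \<Rightarrow> ('a \<Rightarrow> ennreal) \<Rightarrow> 'a \<Rightarrow> ennreal" where
  "killed_step G B h u = indicator (- B) u * (\<integral>\<^sup>+x. h x \<partial>measure_pmf (pmf_of_set (neighbours G u)))"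

definition avoiding :: "'a set \<Rightarrow> nat \<Rightarrow> (nat \<Rightarrow> 'a) set" where
  "avoiding B n = {\<omega>. \<forall>i\<le>n. \<omega> i \<notin> B}"

text \<open>
  The walk avoids \<open>B\<close> up to time \<open>n\<close> exactly for the \<open>n\<close> below the hitting time, so counting these
  \<open>n\<close> recovers it; for a walk that never hits, both sides are infinite.
\<close>

lemma hitting_time_eq_suminf:
  "hitting_time B \<omega> = (\<Sum>n. indicator (avoiding B n) \<omega>)"
proof (cases "\<exists>n. \<omega> n \<in> B")
  case False
  then have "(\<Sum>n. indicator (avoiding B n) \<omega> :: ennreal) = (\<Sum>n. 1)"
    by (simp add: avoiding_def)
  also have "\<dots> = \<infinity>"
    using summable_suminf_not_top[of "\<lambda>_. 1"] by (auto simp: summable_const_iff)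
  finally show ?thesis
    using False by (simp add: hitting_time_def)
next
  case True
  define N where "N = (LEAST n. \<omega> n \<in> B)"
  have N: "\<omega> N \<in> B" and least: "\<omega> n \<in> B \<Longrightarrow> N \<le> n" for n
    using True by (auto simp: N_def intro: LeastI_ex Least_le)
  have "\<omega> \<in> avoiding B n \<longleftrightarrow> n < N" for n
    unfolding avoiding_def mem_Collect_eq using N least by (metis leI le_trans not_le)
  then have "(\<Sum>n. indicator (avoiding B n) \<omega> :: ennreal) = (\<Sum>n. if n < N then 1 else 0)"
    by (simp add: indicator_def of_bool_def)
  also have "\<dots> = (\<Sum>n<N. if n < N then 1 else 0)"
    by (rule suminf_finite) auto
  also have "\<dots> = of_nat N"
    by simp
  also have "\<dots> = hitting_time B \<omega>"
    unfolding hitting_time_def using N least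
    by (intro antisym INF_greatest INF_lower) auto
  finally show ?thesis
    by simp
qed

text \<open>The joint law of the positions at times \<open>0, \<dots>, n - 1\<close>.\<close>

abbreviation walk_prefix :: "('a, 'b) pre_digraph \<Rightarrow> 'a \<Rightarrow> nat \<Rightarrow> (nat \<Rightarrow> 'a) measure" where
  "walk_prefix G v n \<equiv>
    Ionescu_Tulcea.C (walk_step G v) (\<lambda>_. count_space UNIV) 0 n (\<lambda>_. undefined)"

lemma indicator_avoiding_Suc:
  "indicator (avoiding B (Suc n)) (fun_upd \<omega> (Suc n) x) =
    (indicator (avoiding B n) \<omega> * indicator (- B) x :: ennreal)"
  by (auto simp: avoiding_def indicator_def le_Suc_eq)

lemma measurable_at:
  assumes "n \<in> I"
  shows "(\<lambda>\<omega>. h (\<omega> n) :: ennreal) \<in> borel_measurable (Pi\<^sub>M I (\<lambda>_. count_space UNIV))"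
  by (rule measurable_compose[OF measurable_component_singleton[OF assms]]) simp

lemma measurable_avoiding [measurable]:
  assumes "{..n} \<subseteq> I"
  shows "(\<lambda>\<omega>. indicator (avoiding B n) \<omega> :: ennreal)
    \<in> borel_measurable (Pi\<^sub>M I (\<lambda>_. count_space UNIV))"
proof -
  have "(\<lambda>\<omega>. indicator (avoiding B n) \<omega> :: ennreal) = (\<lambda>\<omega>. \<Prod>i\<le>n. indicator (- B) (\<omega> i))"
    by (auto simp: avoiding_def indicator_def fun_eq_iff)
  also have "\<dots> \<in> borel_measurable (Pi\<^sub>M I (\<lambda>_. count_space UNIV))"
    using assms by (intro borel_measurable_prod_ennreal measurable_at) auto
  finally show ?thesis .
qed

text \<open>
  The induction generalises over the weight \<open>h\<close> at the endpoint: integrating out the last step turns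
  the weight \<open>h\<close> at time \<open>n + 1\<close> into its average over the neighbours at time \<open>n\<close>, which is again
  a weight at the endpoint.
\<close>

lemma nn_integral_avoiding:
  "(\<integral>\<^sup>+\<omega>. indicator (avoiding B n) \<omega> * h (\<omega> n) \<partial>walk_prefix G v (Suc n)) =
    (killed_step G B ^^ n) (\<lambda>u. indicator (- B) u * h u) v"
proof (induction n arbitrary: h)
  interpret walk: Ionescu_Tulcea "walk_step G v" "\<lambda>_. count_space UNIV"
    by (rule Ionescu_Tulcea_walk_step)
  case 0
  have *: "(\<lambda>_. undefined) \<in> space (Pi\<^sub>M {0..<0::nat} (\<lambda>_. count_space (UNIV :: 'a set)))"
    by (simp add: space_PiM)
  have meas: "(\<lambda>\<omega>. indicator (avoiding B 0) \<omega> * h (\<omega> 0))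
      \<in> borel_measurable (Pi\<^sub>M {0..<Suc 0} (\<lambda>_. count_space UNIV))"
    by (intro borel_measurable_times_ennreal measurable_avoiding measurable_at) auto
  have step0: "walk_step G v 0 (\<lambda>_. undefined) = measure_pmf (return_pmf v)"
    by (simp add: walk_step_def)
  have "walk_prefix G v (Suc 0) = walk.eP 0 (\<lambda>_. undefined)"
    using bind_return[OF walk.measurable_eP *] by simp
  then have "(\<integral>\<^sup>+\<omega>. indicator (avoiding B 0) \<omega> * h (\<omega> 0) \<partial>walk_prefix G v (Suc 0)) =
      (\<integral>\<^sup>+x. indicator (- B) x * h x \<partial>walk_step G v 0 (\<lambda>_. undefined))"
    unfolding walk.nn_integral_eP[OF * meas, folded \<open>walk_prefix G v (Suc 0) = _\<close>]
    by (auto simp: avoiding_def indicator_def intro!: nn_integral_cong)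
  then show ?case
    using step0 by (simp del: walk.C.simps)
next
  interpret walk: Ionescu_Tulcea "walk_step G v" "\<lambda>_. count_space UNIV"
    by (rule Ionescu_Tulcea_walk_step)
  case (Suc n)
  let ?M = "\<lambda>_::nat. count_space (UNIV :: 'a set)"
  let ?E = "\<lambda>\<omega>. \<integral>\<^sup>+x. indicator (- B) x * h x \<partial>measure_pmf (pmf_of_set (neighbours G (\<omega> n)))"
  have u: "(\<lambda>_. undefined) \<in> space (Pi\<^sub>M {0..<0} ?M)"
    by (simp add: space_PiM)
  have meas: "(\<lambda>\<omega>. indicator (avoiding B (Suc n)) \<omega> * h (\<omega> (Suc n)))
      \<in> borel_measurable (Pi\<^sub>M {0..<Suc (Suc n)} ?M)"
    by (intro borel_measurable_times_ennreal measurable_avoiding measurable_at) auto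
  have "(\<integral>\<^sup>+\<omega>. indicator (avoiding B (Suc n)) \<omega> * h (\<omega> (Suc n)) \<partial>walk_prefix G v (Suc (Suc n))) =
      (\<integral>\<^sup>+\<omega>. (\<integral>\<^sup>+\<eta>. indicator (avoiding B (Suc n)) \<eta> * h (\<eta> (Suc n)) \<partial>walk.eP (Suc n) \<omega>)
        \<partial>walk_prefix G v (Suc n))"
    using meas walk.measurable_eP[of "Suc n"]
    by (subst walk.C.simps(2), subst nn_integral_bind[where B="Pi\<^sub>M {0..<Suc (Suc n)} ?M"])
       (auto simp: measurable_cong_sets[OF walk.sets_C[OF u] refl] simp del: walk.C.simps)
  also have "\<dots> = (\<integral>\<^sup>+\<omega>. indicator (avoiding B n) \<omega> * ?E \<omega> \<partial>walk_prefix G v (Suc n))"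
  proof (rule nn_integral_cong)
    fix \<omega> assume "\<omega> \<in> space (walk_prefix G v (Suc n))"
    then have "\<omega> \<in> space (Pi\<^sub>M {0..<Suc n} ?M)"
      using walk.space_C[OF u] by (simp del: walk.C.simps)
    from walk.nn_integral_eP[OF this meas]
    show "(\<integral>\<^sup>+\<eta>. indicator (avoiding B (Suc n)) \<eta> * h (\<eta> (Suc n)) \<partial>walk.eP (Suc n) \<omega>) =
        indicator (avoiding B n) \<omega> * ?E \<omega>"
      by (simp add: walk_step_def indicator_avoiding_Suc mult.assoc nn_integral_cmult)
  qed
  also have "\<dots> = (killed_step G B ^^ n) (killed_step G B (\<lambda>u. indicator (- B) u * h u)) v"
    unfolding killed_step_def[of G B "\<lambda>u. indicator (- B) u * h u", abs_def] by (rule Suc)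
  finally show ?case
    by (simp only: funpow_Suc_right o_apply)
qed

lemma sets_random_walk: "sets (random_walk G v) = sets (Pi\<^sub>M UNIV (\<lambda>_. count_space UNIV))"
proof -
  interpret walk: Ionescu_Tulcea "walk_step G v" "\<lambda>_. count_space UNIV"
    by (rule Ionescu_Tulcea_walk_step)
  show ?thesis
    unfolding random_walk_def by (rule walk.PF.sets_lim)
qed

text \<open>
  Avoiding \<open>B\<close> up to time \<open>n\<close> is a cylinder event, on which the limit measure agrees with the law of
  the first \<open>n + 1\<close> positions.
\<close>

lemma nn_integral_random_walk_avoiding:
  "(\<integral>\<^sup>+\<omega>. indicator (avoiding B n) \<omega> \<partial>random_walk G v) = (killed_step G B ^^ n) (indicator (- B)) v"
proof -
  interpret walk: Ionescu_Tulcea "walk_step G v" "\<lambda>_. count_space UNIV"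
    by (rule Ionescu_Tulcea_walk_step)
  let ?J = "{0..<Suc n}" and ?M = "\<lambda>_::nat. count_space (UNIV :: 'a set)"
  define X where "X = avoiding B n \<inter> space (Pi\<^sub>M ?J ?M)"
  have J: "{..n} \<subseteq> ?J" by auto
  have X: "X \<in> sets (Pi\<^sub>M ?J ?M)"
    using measurable_avoiding[OF J, of B] unfolding X_def
    by (simp add: borel_measurable_indicator_iff)
  have emb: "prod_emb UNIV ?M ?J X = avoiding B n"
    by (auto simp: prod_emb_def X_def space_PiM avoiding_def PiE_iff)
  have sets: "avoiding B n \<in> sets (random_walk G v)"
    unfolding sets_random_walk
    using measurable_avoiding[of n UNIV B]
    by (simp add: borel_measurable_indicator_iff space_PiM)
  have "(\<integral>\<^sup>+\<omega>. indicator (avoiding B n) \<omega> \<partial>random_walk G v) = emeasure (random_walk G v) (avoiding B n)"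
    using sets by simp
  also have "\<dots> = emeasure (walk.CI ?J) X"
    unfolding random_walk_def using walk.lim[OF _ X] by (simp add: emb)
  also have "\<dots> = emeasure (walk_prefix G v (Suc n)) X"
    using walk.emeasure_CI[OF order_refl X] X[THEN sets.sets_into_space]
    by (simp add: prod_emb_id space_PiM del: walk.C.simps)
  also have "\<dots> = (\<integral>\<^sup>+\<omega>. indicator X \<omega> \<partial>walk_prefix G v (Suc n))"
    using X by (simp add: walk.sets_C space_PiM del: walk.C.simps)
  also have "\<dots> = (\<integral>\<^sup>+\<omega>. indicator (avoiding B n) \<omega> * (\<lambda>_. 1) (\<omega> n)
      \<partial>walk_prefix G v (Suc n))"
    by (intro nn_integral_cong)
       (simp add: X_def walk.space_C space_PiM indicator_def del: walk.C.simps)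
  also have "\<dots> = (killed_step G B ^^ n) (indicator (- B)) v"
    by (subst nn_integral_avoiding) simp
  finally show ?thesis .
qed

lemma mean_hitting_time_eq_suminf:
  "mean_hitting_time G v = (\<Sum>n. (killed_step G (boundary G) ^^ n) (indicator (- boundary G)) v)"
proof -
  have "(\<lambda>\<omega>. indicator (avoiding (boundary G) n) \<omega> :: ennreal) \<in> borel_measurable (random_walk G v)" for n
    using measurable_avoiding[of n UNIV "boundary G"]
    by (subst measurable_cong_sets[OF sets_random_walk refl]) auto
  then show ?thesis
    unfolding mean_hitting_time_def hitting_time_eq_suminf nn_integral_random_walk_avoiding[symmetric]
    by (rule nn_integral_suminf)
qed

text \<open>
  The term \<open>n = 0\<close> contributes \<open>1\<close>; in the term \<open>n + 1\<close> the outermost killed step is the first step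
  of the walk, and what remains is the term \<open>n\<close> of the series for its target.
\<close>

lemma mean_hitting_time_first_step:
  assumes "v \<notin> boundary G"
  shows "mean_hitting_time G v =
    1 + (\<integral>\<^sup>+x. mean_hitting_time G x \<partial>measure_pmf (pmf_of_set (neighbours G v)))"
proof -
  let ?s = "\<lambda>n. (killed_step G (boundary G) ^^ n) (indicator (- boundary G))"
  have "mean_hitting_time G v = ?s 0 v + (\<Sum>n. ?s (Suc n) v)"
    unfolding mean_hitting_time_eq_suminf
    by (subst suminf_offset[of _ "Suc 0"]) auto
  also have "?s 0 v = 1"
    using assms by simp
  also have "(\<Sum>n. ?s (Suc n) v) =
      (\<Sum>n. \<integral>\<^sup>+x. ?s n x \<partial>measure_pmf (pmf_of_set (neighbours G v)))"
    using assms by (simp add: killed_step_def)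
  also have "\<dots> = (\<integral>\<^sup>+x. mean_hitting_time G x \<partial>measure_pmf (pmf_of_set (neighbours G v)))"
    unfolding mean_hitting_time_eq_suminf by (rule nn_integral_suminf[symmetric]) simp
  finally show ?thesis .
qed

section \<open>Barta's trick on the edges\<close>

lemma (in fin_digraph) finite_neighbours: "finite (neighbours G u)"
  by (rule finite_subset[of _ "verts G"]) (auto simp: neighbours_def dest: adj_in_verts)

text \<open>
  An undirected edge is the image of exactly two arcs, since there are no loops; hence a sum over arcs
  collects the two orientations of each edge.
\<close>

lemma sum_arcs_le_sum_edges:
  fixes g :: "'a \<Rightarrow> 'a \<Rightarrow> real"
  assumes "Digraph.graph G"
    and le: "\<And>u v. u \<rightarrow>\<^bsub>G\<^esub> v \<Longrightarrow> g u v + g v u \<le> F (Upair u v)"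
  shows "(\<Sum>u\<in>verts G. \<Sum>x\<in>neighbours G u. g u x) \<le> (\<Sum>e\<in>edges G. F e)"
proof -
  interpret graph G by fact
  let ?A = "arcs_ends G" and ?e = "\<lambda>(u, v). Upair u v"
  have fin: "finite ?A"
    by (simp add: arcs_ends_def)
  have edges: "edges G = ?e ` ?A"
    by (auto simp: edges_def)
  have A: "?A = Sigma (verts G) (neighbours G)"
    by (auto simp: neighbours_def dest: adj_in_verts)
  have "(\<Sum>u\<in>verts G. \<Sum>x\<in>neighbours G u. g u x) = (\<Sum>(u, v)\<in>?A. g u v)"
    unfolding A by (simp add: sum.Sigma finite_neighbours)
  also have "\<dots> = (\<Sum>e\<in>?e ` ?A. \<Sum>p | p \<in> ?A \<and> ?e p = e. case p of (u, v) \<Rightarrow> g u v)"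
    using fin by (rule sum.image_gen)
  also have "\<dots> \<le> (\<Sum>e\<in>?e ` ?A. F e)"
  proof (rule sum_mono, clarify)
    fix u v assume uv: "u \<rightarrow>\<^bsub>G\<^esub> v"
    have vu: "v \<rightarrow>\<^bsub>G\<^esub> u"
      using uv sym_arcs by (rule arcs_ends_symmetric[rotated])
    have "u \<noteq> v"
      using uv adj_not_same by blast
    moreover have "{p. p \<in> ?A \<and> ?e p = Upair u v} = {(u, v), (v, u)}"
      using uv vu by auto
    ultimately show "(\<Sum>p | p \<in> ?A \<and> ?e p = Upair u v. case p of (u, v) \<Rightarrow> g u v) \<le> F (Upair u v)"
      using le[OF uv] by simp
  qed
  finally show ?thesis
    by (simp add: edges)
qed

text \<open>
  For positive weights the difference of the two sides is \<open>(b x - a y)\<^sup>2 / (a b)\<close>. A vanishing weight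
  removes its summand, as division by \<open>0\<close> yields \<open>0\<close>; the remaining summand \<open>x\<^sup>2\<close> or \<open>y\<^sup>2\<close> is below
  \<open>(x - y)\<^sup>2\<close> as soon as the mixed term is \<open>0\<close>.
\<close>

lemma square_diff_ge_weighted:
  fixes x y a b :: real
  assumes "a \<ge> 0" "b \<ge> 0" and "a = 0 \<Longrightarrow> b \<noteq> 0 \<Longrightarrow> x * y = 0" "b = 0 \<Longrightarrow> a \<noteq> 0 \<Longrightarrow> x * y = 0"
  shows "x\<^sup>2 / a * (a - b) + y\<^sup>2 / b * (b - a) \<le> (x - y)\<^sup>2"
proof (cases "a = 0 \<or> b = 0")
  case True
  then show ?thesis
    using assms sum_squares_bound[of x y] by (auto simp: power2_diff)
next
  case False
  then have "a > 0" "b > 0"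
    using assms by auto
  then have "(x - y)\<^sup>2 - (x\<^sup>2 / a * (a - b) + y\<^sup>2 / b * (b - a)) = (b * x - a * y)\<^sup>2 / (a * b)"
    by (simp add: field_simps power2_eq_square)
  also have "\<dots> \<ge> 0"
    using \<open>a > 0\<close> \<open>b > 0\<close> by simp
  finally show ?thesis by simp
qed

theorem theorem3:
  fixes G :: "('a, 'b) pre_digraph" and f :: "'a \<Rightarrow> real"
  assumes "Digraph.graph G" and "Digraph_Component.connected G" and "card (verts G) \<ge> 2"
    and "\<And>v. v \<in> boundary G \<Longrightarrow> f v = 0"
  shows "(\<Sum>e\<in>edges G. sq_diff f e) \<ge>
    (\<Sum>v\<in>verts G. if v \<in> boundary G then 0
                    else real (deg G v) * ((f v)\<^sup>2 / enn2real (mean_hitting_time G v)))"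
proof -
  interpret graph G by fact
  \<comment> \<open>An infinite mean hitting time becomes \<open>h v = 0\<close>, which also makes the right-hand term of \<open>v\<close> zero.\<close>
  define h where "h v = enn2real (mean_hitting_time G v)" for v
  have h_nonneg: "h v \<ge> 0" for v
    by (simp add: h_def)
  have first_step: "mean_hitting_time G v = 1 + (\<Sum>x\<in>neighbours G v. mean_hitting_time G x) / deg G v"
    if "v \<notin> boundary G" "neighbours G v \<noteq> {}" for v
    using mean_hitting_time_first_step[OF that(1)] nn_integral_pmf_of_set[OF that(2) finite_neighbours]
    by (simp add: deg_def)
  have finite_nbr: "mean_hitting_time G x < \<top>"
    if "v \<notin> boundary G" "h v \<noteq> 0" "x \<in> neighbours G v" for v x
  proof -
    have "mean_hitting_time G v < \<top>"
      using that(2) by (auto simp: h_def enn2real_eq_0_iff less_top)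
    then have "(\<Sum>x\<in>neighbours G v. mean_hitting_time G x) < \<top>"
      using first_step[OF that(1)] that(3) ennreal_top_divide[of "of_nat (deg G v)"]
      by (cases "(\<Sum>x\<in>neighbours G v. mean_hitting_time G x) = \<top>") (auto simp: less_top[symmetric])
    then show ?thesis
      using finite_neighbours that(3) by (simp add: less_top)
  qed
  \<comment> \<open>The first-step equation, multiplied by \<open>deg v\<close>, evaluates the vertex sums.\<close>
  have vertex: "real (deg G v) * ((f v)\<^sup>2 / h v) = (\<Sum>x\<in>neighbours G v. (f v)\<^sup>2 / h v * (h v - h x))"
    if v: "v \<notin> boundary G" for v
  proof (cases "h v = 0 \<or> neighbours G v = {}")
    case True
    then show ?thesis by (auto simp: deg_def)
  next
    case False
    then have "deg G v > 0"
      using finite_neighbours by (simp add: deg_def card_gt_0_iff)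
    have "mean_hitting_time G v = ennreal (1 + (\<Sum>x\<in>neighbours G v. h x) / deg G v)"
    proof -
      have "(\<Sum>x\<in>neighbours G v. mean_hitting_time G x) = ennreal (\<Sum>x\<in>neighbours G v. h x)"
        using finite_nbr[OF v] False by (simp add: h_def sum_ennreal[symmetric] less_top)
      then show ?thesis
        using first_step[OF v] False \<open>deg G v > 0\<close>
        by (simp add: h_nonneg sum_nonneg divide_ennreal ennreal_of_nat_eq_real_of_nat
            flip: ennreal_1 ennreal_plus)
    qed
    then have "h v = 1 + (\<Sum>x\<in>neighbours G v. h x) / deg G v"
      unfolding h_def[of v]
      by (simp only: enn2real_ennreal h_nonneg sum_nonneg divide_nonneg_nonneg
          add_nonneg_nonneg zero_le_one of_nat_0_le_iff)
    then have "(\<Sum>x\<in>neighbours G v. h v - h x) = deg G v"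
      using \<open>deg G v > 0\<close> by (simp add: sum_subtractf deg_def field_simps)
    then show ?thesis
      unfolding sum_distrib_left[symmetric] by simp
  qed
  \<comment> \<open>Off the boundary \<open>h u = 0\<close> would mean an infinite mean hitting time at \<open>u\<close>, which an interior
    neighbour \<open>v\<close> with finite mean hitting time excludes.\<close>
  have zero_weight: "f u = 0 \<or> f v = 0" if "u \<rightarrow>\<^bsub>G\<^esub> v" "h u = 0" "h v \<noteq> 0" for u v
  proof (cases "v \<in> boundary G \<or> u \<in> boundary G")
    case True
    then show ?thesis using assms(4) by auto
  next
    case False
    have "u \<in> neighbours G v"
      using that(1) arcs_ends_symmetric[OF sym_arcs] by (simp add: neighbours_def)
    with False that have "mean_hitting_time G u < \<top>"
      using finite_nbr by blast
    moreover have "mean_hitting_time G u \<noteq> 0"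
      using mean_hitting_time_first_step[of u G] False by simp
    ultimately show ?thesis
      using that(2) by (simp add: h_def enn2real_eq_0_iff)
  qed
  have "(\<Sum>v\<in>verts G. if v \<in> boundary G then 0 else real (deg G v) * ((f v)\<^sup>2 / h v))
      = (\<Sum>v\<in>verts G. \<Sum>x\<in>neighbours G v. (f v)\<^sup>2 / h v * (h v - h x))"
    using vertex assms(4) by (intro sum.cong) auto
  also have "\<dots> \<le> (\<Sum>e\<in>edges G. sq_diff f e)"
  proof (rule sum_arcs_le_sum_edges[OF assms(1)])
    fix u v assume uv: "u \<rightarrow>\<^bsub>G\<^esub> v"
    then have "v \<rightarrow>\<^bsub>G\<^esub> u"
      using arcs_ends_symmetric[OF sym_arcs] by blast
    with uv show "(f u)\<^sup>2 / h u * (h u - h v) + (f v)\<^sup>2 / h v * (h v - h u) \<le> sq_diff f (Upair u v)"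
      using zero_weight[of u v] zero_weight[of v u] unfolding sq_diff_Upair
      by (intro square_diff_ge_weighted h_nonneg) auto
  qed
  finally show ?thesis
    unfolding h_def .
qed

end
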